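(* Let $(X_t)_{t\ge1}$ be an exchangeable $\{0,1\}$-valued sequence on a probability space $(\Omega,\mathcal F,\mathbb P)$, with natural filtration $\mathcal F_t=\sigma(X_1,\ldots,X_t)$ ($\mathcal F_0$ trivial). Let $\Theta\in[0,1]$ be the latent random variable from de Finetti's representation, i.e. conditional on $\Theta$ the variables $(X_t)_{t\ge1}$ are i.i.d. $\mathrm{Bernoulli}(\Theta)$. For $t\ge0$ define $p_t:=\mathbb P(X_{t+1}=1\mid\mathcal F_t)$. Then: (1) $(p_t,\mathcal F_t)_{t\ge0}$ is a bounded martingale and $p_t\to\Theta$ almost surely. (2) The empirical mean $\bar X_n:=\frac1n\sum_{t=1}^n X_t$ converges almost surely to the same limit: $\bar X_n\to\Theta$ almost surely.
   Context: A $\{0,1\}$-valued sequence $(X_t)_{t\ge1}$ is exchangeable if for every $n\ge1$ and every permutation $\pi$ of $\{1,\ldots,n\}$, $(X_1,\ldots,X_n)$ and $(X_{\pi(1)},\ldots,X_{\pi(n)})$ have the same distribution. De Finetti's representation theorem (binary case): if $(X_t)_{t\ge1}$ is exchangeable and $\{0,1\}$-valued, there exists a random variable $\Theta\in[0,1]$ such that, conditional on $\Theta$, the $X_t$ are i.i.d. $\mathrm{Bernoulli}(\Theta)$. *)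

theory Defs
  imports "HOL-Probability.Probability" "HOL-Combinatorics.Permutations"
begin

text \<open>
  Processes \<open>X :: nat \<Rightarrow> 'a \<Rightarrow> real\<close> are indexed from \<open>1\<close>; the value \<open>X 0\<close> is never used.
  Binary variables are real-valued with values in \<open>{0, 1}\<close>.
\<close>

definition exchangeable :: "'a measure \<Rightarrow> (nat \<Rightarrow> 'a \<Rightarrow> real) \<Rightarrow> bool" where
  "exchangeable M X \<longleftrightarrow>
     (\<forall>n\<ge>1. \<forall>\<pi>. \<pi> permutes {1..n} \<longrightarrow>
        distr M (\<Pi>\<^sub>M i\<in>{1..n}. borel) (\<lambda>\<omega>. \<lambda>i\<in>{1..n}. X i \<omega>) =
        distr M (\<Pi>\<^sub>M i\<in>{1..n}. borel) (\<lambda>\<omega>. \<lambda>i\<in>{1..n}. X (\<pi> i) \<omega>))"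

definition natural_filtration :: "'a measure \<Rightarrow> (nat \<Rightarrow> 'a \<Rightarrow> real) \<Rightarrow> nat \<Rightarrow> 'a measure" where
  "natural_filtration M X t =
     sigma (space M) (\<Union>i\<in>{1..t}. {X i -` A \<inter> space M | A. A \<in> sets borel})"

definition subalg_prob :: "'a measure \<Rightarrow> 'a measure \<Rightarrow> 'a set \<Rightarrow> 'a \<Rightarrow> real" where
  "subalg_prob M G E = real_cond_exp M G (indicator E)"

definition cond_indep_vars ::
  "'a measure \<Rightarrow> 'a measure \<Rightarrow> ('i \<Rightarrow> 'a \<Rightarrow> real) \<Rightarrow> 'i set \<Rightarrow> bool" where
  "cond_indep_vars M G X I \<longleftrightarrow>
     (\<forall>J A. J \<subseteq> I \<and> J \<noteq> {} \<and> finite J \<and> (\<forall>j\<in>J. A j \<in> sets borel) \<longrightarrow>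
        (AE \<omega> in M. subalg_prob M G {x \<in> space M. \<forall>j\<in>J. X j x \<in> A j} \<omega> =
           (\<Prod>j\<in>J. subalg_prob M G {x \<in> space M. X j x \<in> A j} \<omega>)))"

text \<open>
  The kernel \<open>\<omega> \<mapsto> bernoulli_pmf (\<Theta> \<omega>)\<close>, transported from \<open>bool\<close> to the reals,
  is a version of the conditional law of \<open>Y\<close> given \<open>\<sigma>(\<Theta>)\<close>.
\<close>

definition cond_bernoulli :: "'a measure \<Rightarrow> ('a \<Rightarrow> real) \<Rightarrow> ('a \<Rightarrow> real) \<Rightarrow> bool" where
  "cond_bernoulli M \<Theta> Y \<longleftrightarrow>
     (\<forall>A\<in>sets borel. AE \<omega> in M.
        subalg_prob M (vimage_algebra (space M) \<Theta> borel) {x \<in> space M. Y x \<in> A} \<omega> =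
        measure_pmf.prob (map_pmf of_bool (bernoulli_pmf (\<Theta> \<omega>))) A)"

definition cond_iid_bernoulli ::
  "'a measure \<Rightarrow> ('a \<Rightarrow> real) \<Rightarrow> ('i \<Rightarrow> 'a \<Rightarrow> real) \<Rightarrow> 'i set \<Rightarrow> bool" where
  "cond_iid_bernoulli M \<Theta> X I \<longleftrightarrow>
     cond_indep_vars M (vimage_algebra (space M) \<Theta> borel) X I \<and>
     (\<forall>i\<in>I. cond_bernoulli M \<Theta> (X i))"

definition martingale :: "'a measure \<Rightarrow> (nat \<Rightarrow> 'a measure) \<Rightarrow> (nat \<Rightarrow> 'a \<Rightarrow> real) \<Rightarrow> bool" where
  "martingale M F Z \<longleftrightarrow>
     filtration (space M) F \<and> (\<forall>t. subalgebra M (F t)) \<and>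
     (\<forall>t. Z t \<in> borel_measurable (F t)) \<and> (\<forall>t. integrable M (Z t)) \<and>
     (\<forall>s t. s \<le> t \<longrightarrow> (AE \<omega> in M. real_cond_exp M (F s) (Z t) \<omega> = Z s \<omega>))"

text \<open>
  Boundedness is uniform in time and almost sure in \<open>\<omega>\<close>, since conditional probabilities
  are determined only up to null sets.
\<close>

definition bounded_martingale ::
  "'a measure \<Rightarrow> (nat \<Rightarrow> 'a measure) \<Rightarrow> (nat \<Rightarrow> 'a \<Rightarrow> real) \<Rightarrow> bool" where
  "bounded_martingale M F Z \<longleftrightarrow>
     martingale M F Z \<and> (\<exists>C. AE \<omega> in M. \<forall>t. \<bar>Z t \<omega>\<bar> \<le> C)"

definition predictive_prob :: "'a measure \<Rightarrow> (nat \<Rightarrow> 'a \<Rightarrow> real) \<Rightarrow> nat \<Rightarrow> 'a \<Rightarrow> real" where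
  "predictive_prob M X t =
     subalg_prob M (natural_filtration M X t) {\<omega> \<in> space M. X (t + 1) \<omega> = 1}"

definition empirical_mean :: "(nat \<Rightarrow> 'a \<Rightarrow> real) \<Rightarrow> nat \<Rightarrow> 'a \<Rightarrow> real" where
  "empirical_mean X n \<omega> = (1 / real n) * (\<Sum>t=1..n. X t \<omega>)"

end

theory Submission
  imports Defs
begin

text \<open>
  Write \<open>S\<^sub>n = \<Sum>i=1..n. (X i - \<Theta>)\<close> and let \<open>F\<^sub>n\<close> be the natural filtration. Conditional
  independence together with the Bernoulli law says that, given the parameter and the past jointly,
  the next variable has conditional mean \<open>\<Theta>\<close> (\<open>cond_exp_next_given_latent_past\<close>). Everything
  else follows from this single identity.

  By the tower property, \<open>p\<^sub>n = E[\<Theta> | F\<^sub>n]\<close> almost surely, so \<open>p\<close> is a martingale, almost surely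
  with values in \<open>[0, 1]\<close>.

  The identity also makes every power of \<open>S\<^sub>n\<close> orthogonal to the next increment, which yields
  \<open>E[S\<^sub>n\<^sup>4] \<le> 4 n\<^sup>2\<close> (\<open>centred_sum_fourth_moment\<close>). Hence the fourth moments of
  \<open>\<Theta> - m\<^sub>n\<close>, where \<open>m\<^sub>n\<close> is the empirical mean, are at most \<open>4 / n\<^sup>2\<close>. These are summable,
  and the empirical means converge to \<open>\<Theta>\<close> almost surely.

  For the predictive probabilities no martingale convergence theorem is needed. The empirical mean is
  \<open>F\<^sub>n\<close>-measurable, so \<open>p\<^sub>n - m\<^sub>n = E[\<Theta> - m\<^sub>n | F\<^sub>n]\<close>, and the conditional Jensen inequality for
  \<open>x\<^sup>4\<close> transfers the bound \<open>4 / n\<^sup>2\<close> to \<open>p\<^sub>n - m\<^sub>n\<close> (\<open>predictive_error_moment4\<close>).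
  This difference therefore tends to \<open>0\<close> almost surely, and \<open>p\<^sub>n\<close> has the same limit as the
  empirical mean.
\<close>

section \<open>Two tools from measure theory\<close>

text \<open>
  A conditional expectation given \<open>\<sigma>(E)\<close> is determined by its integrals over an
  intersection-stable generator \<open>E\<close>.
\<close>

lemma (in finite_measure) real_cond_exp_charact_generator:
  assumes E: "Int_stable E" "E \<subseteq> sets M" "space M \<in> E"
    and f: "integrable M f" and g: "integrable M g"
    and g_meas: "g \<in> borel_measurable (sigma (space M) E)"
    and eq: "\<And>A. A \<in> E \<Longrightarrow> (\<integral>x\<in>A. f x \<partial>M) = (\<integral>x\<in>A. g x \<partial>M)"
  shows "AE x in M. real_cond_exp M (sigma (space M) E) f x = g x"
proof -
  have Pow: "E \<subseteq> Pow (space M)"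
    using E(2) sets.sets_into_space by blast
  have sets_E: "sets (sigma (space M) E) = sigma_sets (space M) E"
    using Pow by simp
  have sub: "sigma_sets (space M) E \<subseteq> sets M"
    using E(2) by (rule sets.sigma_sets_subset)
  interpret S: finite_measure_subalgebra M "sigma (space M) E"
    by unfold_locales (use sub sets_E in \<open>auto simp: subalgebra_def space_measure_of_conv\<close>)
  have int: "set_integrable M A h" if "A \<in> sigma_sets (space M) E" "integrable M h"
    for A and h :: "'a \<Rightarrow> real"
    unfolding set_integrable_def using that sub by (intro integrable_mult_indicator) auto
  have "(\<integral>x\<in>A. f x \<partial>M) = (\<integral>x\<in>A. g x \<partial>M)" if "A \<in> sigma_sets (space M) E" for A
    using E(1) Pow that
  proof (induction rule: sigma_sets_induct_disjoint)
    case (basic A)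
    then show ?case by (rule eq)
  next
    case empty
    show ?case by (simp add: set_lebesgue_integral_def)
  next
    case (compl A)
    have "A \<in> sets M" using compl sub by auto
    have split: "(\<integral>x\<in>space M - A. h x \<partial>M) = (\<integral>x\<in>space M. h x \<partial>M) - (\<integral>x\<in>A. h x \<partial>M)"
      if "integrable M h" for h :: "'a \<Rightarrow> real"
    proof -
      have "(\<integral>x\<in>(space M - A) \<union> A. h x \<partial>M) = (\<integral>x\<in>space M - A. h x \<partial>M) + (\<integral>x\<in>A. h x \<partial>M)"
        using that compl int by (intro set_integral_Un) (auto intro!: int sigma_sets.Compl)
      moreover have "(space M - A) \<union> A = space M"
        using \<open>A \<in> sets M\<close> sets.sets_into_space by blast
      ultimately show ?thesis by simp
    qed
    show ?case
      using split[OF f] split[OF g] compl eq[OF E(3)] by simp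
  next
    case (union A)
    have A: "\<And>i. A i \<in> sets M" "(\<Union>i. A i) \<in> sigma_sets (space M) E"
      using union sub by (auto intro!: sigma_sets.Union)
    have "(\<integral>x\<in>(\<Union>i. A i). h x \<partial>M) = (\<Sum>i. \<integral>x\<in>A i. h x \<partial>M)"
      if "integrable M h" for h :: "'a \<Rightarrow> real"
      using A union(1) that
      by (intro lebesgue_integral_countable_add int) (auto simp: disjoint_family_on_def)
    then show ?case
      using f g union by simp
  qed
  then show ?thesis
    using f g g_meas by (intro S.real_cond_exp_charact) (auto simp: sets_E)
qed

text \<open>
  The random series of fourth powers has finite expectation, hence converges almost surely.
\<close>

lemma AE_tendsto_zero_if_summable_moment4:
  fixes f :: "nat \<Rightarrow> 'a \<Rightarrow> real"
  assumes int: "\<And>n. integrable M (\<lambda>x. f n x ^ 4)"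
    and sum: "summable (\<lambda>n. \<integral>x. f n x ^ 4 \<partial>M)"
  shows "AE x in M. (\<lambda>n. f n x) \<longlonglongrightarrow> 0"
proof -
  have "(\<integral>\<^sup>+ x. (\<Sum>n. ennreal (f n x ^ 4)) \<partial>M) = (\<Sum>n. \<integral>\<^sup>+ x. ennreal (f n x ^ 4) \<partial>M)"
    using borel_measurable_integrable[OF int] by (intro nn_integral_suminf) auto
  also have "\<dots> = (\<Sum>n. ennreal (\<integral>x. f n x ^ 4 \<partial>M))"
    using int by (intro suminf_cong nn_integral_eq_integral) auto
  also have "\<dots> \<noteq> \<infinity>"
    using sum by (simp add: suminf_ennreal_eq[OF _ summable_sums])
  finally have "AE x in M. (\<Sum>n. ennreal (f n x ^ 4)) \<noteq> \<infinity>"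
    using borel_measurable_integrable[OF int] by (intro nn_integral_PInf_AE) auto
  then show ?thesis
  proof eventually_elim
    case (elim x)
    have "summable (\<lambda>n. f n x ^ 4)"
      using elim by (intro summable_suminf_not_top) (auto simp: infinity_ennreal_def)
    then have "(\<lambda>n. f n x ^ 4) \<longlonglongrightarrow> 0" by (rule summable_LIMSEQ_zero)
    then have "(\<lambda>n. sqrt (sqrt (f n x ^ 4))) \<longlonglongrightarrow> sqrt (sqrt 0)"
      by (intro tendsto_real_sqrt)
    moreover have "sqrt (sqrt (f n x ^ 4)) = \<bar>f n x\<bar>" for n
      using real_sqrt_abs[of "(f n x)\<^sup>2"] by simp
    ultimately show ?case by (simp add: tendsto_rabs_zero_iff)
  qed
qed

section \<open>One-step prediction given the parameter and the past\<close>

text \<open>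
  A binary process, indexed from \<open>1\<close>, that is i.i.d. Bernoulli given the random parameter \<open>\<Theta>\<close>.
\<close>

locale bernoulli_mixture = prob_space M for M :: "'a measure" +
  fixes X :: "nat \<Rightarrow> 'a \<Rightarrow> real" and \<Theta> :: "'a \<Rightarrow> real"
  assumes X_measurable: "\<And>t. t \<ge> 1 \<Longrightarrow> X t \<in> borel_measurable M"
    and X_binary: "\<And>t \<omega>. t \<ge> 1 \<Longrightarrow> \<omega> \<in> space M \<Longrightarrow> X t \<omega> \<in> {0, 1}"
    and \<Theta>_measurable [measurable]: "\<Theta> \<in> borel_measurable M"
    and \<Theta>_range: "\<And>\<omega>. \<omega> \<in> space M \<Longrightarrow> \<Theta> \<omega> \<in> {0..1}"
    and cond_iid: "cond_iid_bernoulli M \<Theta> X {1..}"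
begin

text \<open>The \<open>\<sigma>\<close>-algebra generated by \<open>\<Theta>\<close> alone.\<close>

abbreviation latent_algebra :: "'a measure" where
  "latent_algebra \<equiv> vimage_algebra (space M) \<Theta> borel"

text \<open>The event that \<open>X j\<close> lies in \<open>A j\<close> for each \<open>j = 1, \<dots>, n\<close>; for \<open>n = 0\<close> it is the whole space.\<close>

definition past_event :: "nat \<Rightarrow> (nat \<Rightarrow> real set) \<Rightarrow> 'a set" where
  "past_event n A = {\<omega> \<in> space M. \<forall>j\<in>{1..n}. X j \<omega> \<in> A j}"

text \<open>The intersection-stable generator used for the joint \<open>\<sigma>\<close>-algebra of \<open>\<Theta>, X 1, \<dots>, X n\<close>.\<close>

definition cylinders :: "nat \<Rightarrow> 'a set set" where
  "cylinders n = {(\<Theta> -` B \<inter> space M) \<inter> past_event n A | B A.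
     B \<in> sets borel \<and> (\<forall>j. A j \<in> sets borel)}"

text \<open>The \<open>\<sigma>\<close>-algebra generated by \<open>\<Theta>, X 1, \<dots>, X n\<close>.\<close>

definition latent_filtration :: "nat \<Rightarrow> 'a measure" where
  "latent_filtration n = sigma (space M) (cylinders n)"

lemma past_event_sets: "(\<And>j. A j \<in> sets borel) \<Longrightarrow> past_event n A \<in> sets M"
  unfolding past_event_def
  by (rule sets.sets_Collect_finite_All) (auto intro!: measurable_sets_Collect[OF X_measurable])

lemma cylinders_sets: "cylinders n \<subseteq> sets M"
  using past_event_sets by (auto simp: cylinders_def)

lemma cylinders_Pow: "cylinders n \<subseteq> Pow (space M)"
  using cylinders_sets sets.sets_into_space by blast

lemma cylinders_Int_stable: "Int_stable (cylinders n)"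
proof (rule Int_stableI)
  fix C D assume "C \<in> cylinders n" "D \<in> cylinders n"
  then obtain B A B' A' where
    C: "C = (\<Theta> -` B \<inter> space M) \<inter> past_event n A" "B \<in> sets borel" "\<forall>j. A j \<in> sets borel" and
    D: "D = (\<Theta> -` B' \<inter> space M) \<inter> past_event n A'" "B' \<in> sets borel" "\<forall>j. A' j \<in> sets borel"
    unfolding cylinders_def by blast
  have "C \<inter> D = (\<Theta> -` (B \<inter> B') \<inter> space M) \<inter> past_event n (\<lambda>j. A j \<inter> A' j)"
    unfolding C(1) D(1) past_event_def by auto
  then show "C \<inter> D \<in> cylinders n"
    unfolding cylinders_def using C(2,3) D(2,3)
    by (intro CollectI exI[of _ "B \<inter> B'"] exI[of _ "\<lambda>j. A j \<inter> A' j"]) auto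
qed

lemma space_in_cylinders: "space M \<in> cylinders n"
  unfolding cylinders_def past_event_def
  by (rule CollectI, rule exI[of _ UNIV], rule exI[of _ "\<lambda>_. UNIV"]) auto

lemma latent_filtration_subalgebra: "subalgebra M (latent_filtration n)"
  using sets.sigma_sets_subset[OF cylinders_sets] cylinders_Pow
  by (auto simp: subalgebra_def latent_filtration_def space_measure_of_conv)

lemma latent_filtration_finite: "finite_measure_subalgebra M (latent_filtration n)"
  by unfold_locales (rule latent_filtration_subalgebra)

lemma space_latent_filtration: "space (latent_filtration n) = space M"
  using latent_filtration_subalgebra by (simp add: subalgebra_def)

lemma \<Theta>_latent_filtration: "\<Theta> \<in> borel_measurable (latent_filtration n)"
proof (rule measurableI)
  fix B :: "real set" assume "B \<in> sets borel"
  then have "(\<Theta> -` B \<inter> space M) \<inter> past_event n (\<lambda>_. UNIV) \<in> cylinders n"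
    unfolding cylinders_def by (intro CollectI exI[of _ B] exI[of _ "\<lambda>_. UNIV"]) auto
  moreover have "(\<Theta> -` B \<inter> space M) \<inter> past_event n (\<lambda>_. UNIV) = \<Theta> -` B \<inter> space M"
    by (auto simp: past_event_def)
  ultimately show "\<Theta> -` B \<inter> space (latent_filtration n) \<in> sets (latent_filtration n)"
    using cylinders_Pow by (simp add: space_latent_filtration) (simp add: latent_filtration_def)
qed simp

lemma X_latent_filtration:
  assumes "i \<in> {1..n}"
  shows "X i \<in> borel_measurable (latent_filtration n)"
proof (rule measurableI)
  fix B :: "real set" assume "B \<in> sets borel"
  then have "(\<Theta> -` UNIV \<inter> space M) \<inter> past_event n ((\<lambda>_. UNIV)(i := B)) \<in> cylinders n"
    unfolding cylinders_def
    by (intro CollectI exI[of _ UNIV] exI[of _ "(\<lambda>_. UNIV)(i := B)"]) auto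
  moreover have "(\<Theta> -` UNIV \<inter> space M) \<inter> past_event n ((\<lambda>_. UNIV)(i := B)) = X i -` B \<inter> space M"
    using assms by (auto simp: past_event_def split: if_splits)
  ultimately show "X i -` B \<inter> space (latent_filtration n) \<in> sets (latent_filtration n)"
    using cylinders_Pow by (simp add: space_latent_filtration) (simp add: latent_filtration_def)
qed simp

lemma X_abs_le: "t \<ge> 1 \<Longrightarrow> \<omega> \<in> space M \<Longrightarrow> \<bar>X t \<omega>\<bar> \<le> 1"
  using X_binary by fastforce

lemma \<Theta>_abs_le: "\<omega> \<in> space M \<Longrightarrow> \<bar>\<Theta> \<omega>\<bar> \<le> 1"
  using \<Theta>_range by fastforce

lemma integrable_\<Theta>: "integrable M \<Theta>"
  by (rule integrable_const_bound[of _ 1]) (auto simp: \<Theta>_abs_le)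

lemma integrable_X: "t \<ge> 1 \<Longrightarrow> integrable M (X t)"
  by (rule integrable_const_bound[of _ 1]) (auto simp: X_abs_le X_measurable)

lemma latent_algebra_finite: "finite_measure_subalgebra M latent_algebra"
proof unfold_locales
  show "subalgebra M latent_algebra"
    using sets_image_in_sets[OF refl \<Theta>_measurable] by (simp add: subalgebra_def)
qed

lemma success_sets: "t \<ge> 1 \<Longrightarrow> {\<omega> \<in> space M. X t \<omega> = 1} \<in> sets M"
  using measurable_sets_Collect[OF X_measurable, of t "\<lambda>x. x = 1"] by simp

lemma success_prob_given_latent:
  assumes "t \<ge> 1"
  shows "AE \<omega> in M. subalg_prob M latent_algebra {x \<in> space M. X t x \<in> {1}} \<omega> = \<Theta> \<omega>"
proof -
  have "AE \<omega> in M. subalg_prob M latent_algebra {x \<in> space M. X t x \<in> {1}} \<omega> =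
        measure_pmf.prob (map_pmf of_bool (bernoulli_pmf (\<Theta> \<omega>))) {1::real}"
  proof -
    have "cond_bernoulli M \<Theta> (X t)"
      using cond_iid assms by (simp add: cond_iid_bernoulli_def)
    moreover have "{1::real} \<in> sets borel" by simp
    ultimately show ?thesis unfolding cond_bernoulli_def by (rule bspec)
  qed
  then show ?thesis
  proof (rule AE_mp, intro AE_I2 impI)
    fix \<omega> assume \<omega>: "\<omega> \<in> space M"
      and eq: "subalg_prob M latent_algebra {x \<in> space M. X t x \<in> {1}} \<omega> =
        measure_pmf.prob (map_pmf of_bool (bernoulli_pmf (\<Theta> \<omega>))) {1::real}"
    have "(of_bool :: bool \<Rightarrow> real) -` {1} = {True}" by auto
    then have "measure_pmf.prob (map_pmf of_bool (bernoulli_pmf (\<Theta> \<omega>))) {1::real} =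
        pmf (bernoulli_pmf (\<Theta> \<omega>)) True"
      unfolding measure_map_pmf by (simp only: measure_pmf_single)
    also have "\<dots> = \<Theta> \<omega>"
      using \<Theta>_range[OF \<omega>] by simp
    finally show "subalg_prob M latent_algebra {x \<in> space M. X t x \<in> {1}} \<omega> = \<Theta> \<omega>"
      using eq by (rule trans[rotated])
  qed
qed

text \<open>
  The two conditional product formulas, for the past alone and for the past together with success at
  time \<open>Suc n\<close>, differ by the single factor \<open>\<Theta>\<close>.
\<close>

lemma prob_past_and_success_given_latent:
  assumes A: "\<And>j. A j \<in> sets borel"
  shows "AE \<omega> in M. subalg_prob M latent_algebra (past_event (Suc n) (A(Suc n := {1}))) \<omega> =
    \<Theta> \<omega> * subalg_prob M latent_algebra (past_event n A) \<omega>"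
proof (cases "n = 0")
  \<comment> \<open>Conditional independence says nothing about the empty index set.\<close>
  case True
  interpret L: finite_measure_subalgebra M latent_algebra by (rule latent_algebra_finite)
  have "AE \<omega> in M. subalg_prob M latent_algebra (space M) \<omega> = indicator (space M) \<omega>"
    unfolding subalg_prob_def
    by (rule L.real_cond_exp_F_meas)
       (auto intro!: borel_measurable_indicator
         simp: sets.top[of latent_algebra, simplified] less_top[symmetric])
  moreover have "AE \<omega> in M. \<omega> \<in> space M" by simp
  ultimately show ?thesis
    using success_prob_given_latent[of "Suc n", simplified]
    by eventually_elim (auto simp: past_event_def True)
next
  case False
  let ?P = "\<lambda>j A. subalg_prob M latent_algebra {x \<in> space M. X j x \<in> A}"
  have ind: "AE \<omega> in M. subalg_prob M latent_algebra (past_event m A') \<omega> = (\<Prod>j\<in>{1..m}. ?P j (A' j) \<omega>)"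
    if "m > 0" "\<And>j. A' j \<in> sets borel" for m A'
    using cond_iid that unfolding cond_iid_bernoulli_def cond_indep_vars_def past_event_def
    by (auto simp: Suc_le_eq)
  have past: "(\<Prod>j\<in>{1..n}. ?P j ((A(Suc n := {1})) j) \<omega>) = (\<Prod>j\<in>{1..n}. ?P j (A j) \<omega>)" for \<omega>
    by (intro prod.cong) auto
  have "AE \<omega> in M. subalg_prob M latent_algebra (past_event (Suc n) (A(Suc n := {1}))) \<omega> =
      (\<Prod>j\<in>{1..Suc n}. ?P j ((A(Suc n := {1})) j) \<omega>)"
    using A by (intro ind) auto
  moreover have "AE \<omega> in M. subalg_prob M latent_algebra (past_event n A) \<omega> = (\<Prod>j\<in>{1..n}. ?P j (A j) \<omega>)"
    using A False by (intro ind) auto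
  ultimately show ?thesis
    using success_prob_given_latent[of "Suc n", simplified]
    by eventually_elim (simp add: prod.nat_ivl_Suc' past[simplified] mult.commute)
qed

lemma cylinder_integral_eq:
  assumes "C \<in> cylinders n"
  shows "(\<integral>x\<in>C. X (Suc n) x \<partial>M) = (\<integral>x\<in>C. \<Theta> x \<partial>M)"
proof -
  interpret L: finite_measure_subalgebra M latent_algebra by (rule latent_algebra_finite)
  obtain B A where C: "C = (\<Theta> -` B \<inter> space M) \<inter> past_event n A"
    and B [measurable]: "B \<in> sets borel" and A: "\<And>j. A j \<in> sets borel"
    using assms unfolding cylinders_def by blast
  let ?H = "past_event n A" and ?H' = "past_event (Suc n) (A(Suc n := {1}))"
  let ?b = "indicator (\<Theta> -` B \<inter> space M) :: 'a \<Rightarrow> real"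
  have [measurable]: "?H \<in> sets M" "?H' \<in> sets M"
    using A by (auto intro!: past_event_sets)
  have \<Theta>L [measurable]: "\<Theta> \<in> borel_measurable latent_algebra"
    by (rule measurable_vimage_algebra1) auto
  have b [measurable]: "?b \<in> borel_measurable latent_algebra"
    by (intro borel_measurable_indicator in_vimage_algebra B)
  have bM [measurable]: "?b \<in> borel_measurable M"
    by measurable
  have int: "integrable M (\<lambda>x. ?b x * indicator ?H' x)"
    "integrable M (\<lambda>x. (?b x * \<Theta> x) * indicator ?H x)"
    by (rule integrable_const_bound[of _ 1];
        auto simp: indicator_def \<Theta>_abs_le)+
  have "(\<integral>x\<in>C. X (Suc n) x \<partial>M) = (\<integral>x. ?b x * indicator ?H' x \<partial>M)"
    unfolding set_lebesgue_integral_def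
  proof (rule Bochner_Integration.integral_cong[OF refl])
    fix x assume x: "x \<in> space M"
    have "x \<in> ?H' \<longleftrightarrow> x \<in> ?H \<and> X (Suc n) x = 1"
      unfolding past_event_def using x
      by (auto simp: atLeastAtMostSuc_conv)
    then show "indicator C x *\<^sub>R X (Suc n) x = ?b x * indicator ?H' x"
      using X_binary[of "Suc n" x] x by (auto simp: C indicator_def)
  qed
  also have "\<dots> = (\<integral>x. ?b x * subalg_prob M latent_algebra ?H' x \<partial>M)"
    unfolding subalg_prob_def using int by (intro L.real_cond_exp_intg(2)[symmetric]) auto
  also have "\<dots> = (\<integral>x. (?b x * \<Theta> x) * subalg_prob M latent_algebra ?H x \<partial>M)"
  proof (rule integral_cong_AE)
    show "AE x in M. ?b x * subalg_prob M latent_algebra ?H' x =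
        (?b x * \<Theta> x) * subalg_prob M latent_algebra ?H x"
      using prob_past_and_success_given_latent[of A n, OF A] by eventually_elim simp
  qed (auto simp: subalg_prob_def)
  also have "\<dots> = (\<integral>x. (?b x * \<Theta> x) * indicator ?H x \<partial>M)"
    unfolding subalg_prob_def using int by (intro L.real_cond_exp_intg(2)) auto
  also have "\<dots> = (\<integral>x\<in>C. \<Theta> x \<partial>M)"
    unfolding set_lebesgue_integral_def C by (intro Bochner_Integration.integral_cong refl) (auto simp: indicator_def)
  finally show ?thesis .
qed

text \<open>Knowledge of the past does not improve the prediction once the parameter is known.\<close>

lemma cond_exp_next_given_latent_past:
  "AE \<omega> in M. real_cond_exp M (latent_filtration n) (X (Suc n)) \<omega> = \<Theta> \<omega>"
  unfolding latent_filtration_def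
  by (rule real_cond_exp_charact_generator)
     (use \<Theta>_latent_filtration in \<open>auto intro!: integrable_X integrable_\<Theta>
        simp: cylinder_integral_eq cylinders_Int_stable cylinders_sets[THEN subsetD] space_in_cylinders
          latent_filtration_def\<close>)

section \<open>Fourth moments of the centred partial sums\<close>

text \<open>The partial sum \<open>S\<^sub>n\<close> centred at its conditional mean \<open>n \<Theta>\<close>.\<close>

definition centred_sum :: "nat \<Rightarrow> 'a \<Rightarrow> real" where
  "centred_sum n \<omega> = (\<Sum>i=1..n. X i \<omega> - \<Theta> \<omega>)"

lemma centred_abs_le:
  assumes "t \<ge> 1" "\<omega> \<in> space M"
  shows "\<bar>X t \<omega> - \<Theta> \<omega>\<bar> \<le> 1"
  using X_binary[OF assms] \<Theta>_range[OF assms(2)] by auto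

lemma centred_sum_abs_le:
  assumes "\<omega> \<in> space M"
  shows "\<bar>centred_sum n \<omega>\<bar> \<le> real n"
proof -
  have "\<bar>centred_sum n \<omega>\<bar> \<le> (\<Sum>i=1..n. \<bar>X i \<omega> - \<Theta> \<omega>\<bar>)"
    unfolding centred_sum_def by (rule sum_abs)
  also have "\<dots> \<le> (\<Sum>i=1..n. 1)"
    using assms by (intro sum_mono centred_abs_le) auto
  finally show ?thesis by simp
qed

lemma centred_sum_latent_filtration: "centred_sum n \<in> borel_measurable (latent_filtration n)"
  unfolding centred_sum_def
  by (intro borel_measurable_sum borel_measurable_diff X_latent_filtration \<Theta>_latent_filtration)

lemma centred_sum_measurable [measurable]: "centred_sum n \<in> borel_measurable M"
  by (rule measurable_from_subalg[OF latent_filtration_subalgebra centred_sum_latent_filtration])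

lemma integrable_centred_sum_power: "integrable M (\<lambda>\<omega>. centred_sum n \<omega> ^ k)"
  by (rule integrable_const_bound[of _ "real n ^ k"])
     (auto intro!: power_mono simp: power_abs centred_sum_abs_le)

text \<open>
  The power of \<open>S\<^sub>n\<close> is measurable with respect to the parameter and the past, given which the next
  increment has mean zero.
\<close>

lemma centred_sum_power_orthogonal:
  "integrable M (\<lambda>\<omega>. centred_sum n \<omega> ^ k * (X (Suc n) \<omega> - \<Theta> \<omega>))"
  "(\<integral>\<omega>. centred_sum n \<omega> ^ k * (X (Suc n) \<omega> - \<Theta> \<omega>) \<partial>M) = 0"
proof -
  interpret G: finite_measure_subalgebra M "latent_filtration n" by (rule latent_filtration_finite)
  have [measurable]: "X (Suc n) \<in> borel_measurable M" by (simp add: X_measurable)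
  have [measurable]: "(\<lambda>\<omega>. centred_sum n \<omega> ^ k) \<in> borel_measurable (latent_filtration n)"
    using centred_sum_latent_filtration by measurable
  have int: "integrable M (\<lambda>\<omega>. centred_sum n \<omega> ^ k * X (Suc n) \<omega>)"
       "integrable M (\<lambda>\<omega>. centred_sum n \<omega> ^ k * \<Theta> \<omega>)"
    by (rule integrable_const_bound[of _ "real n ^ k * 1"];
        auto intro!: mult_mono power_mono
          simp: abs_mult power_abs centred_sum_abs_le X_abs_le \<Theta>_abs_le simp del: mult_1_right)+
  have "(\<integral>\<omega>. centred_sum n \<omega> ^ k * X (Suc n) \<omega> \<partial>M) =
      (\<integral>\<omega>. centred_sum n \<omega> ^ k * real_cond_exp M (latent_filtration n) (X (Suc n)) \<omega> \<partial>M)"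
    using int(1) by (intro G.real_cond_exp_intg(2)[symmetric]) auto
  also have "\<dots> = (\<integral>\<omega>. centred_sum n \<omega> ^ k * \<Theta> \<omega> \<partial>M)"
    using cond_exp_next_given_latent_past[of n] by (intro integral_cong_AE) auto
  finally have eq: "(\<integral>\<omega>. centred_sum n \<omega> ^ k * X (Suc n) \<omega> \<partial>M) = (\<integral>\<omega>. centred_sum n \<omega> ^ k * \<Theta> \<omega> \<partial>M)" .
  show "integrable M (\<lambda>\<omega>. centred_sum n \<omega> ^ k * (X (Suc n) \<omega> - \<Theta> \<omega>))"
    using int by (simp add: right_diff_distrib)
  show "(\<integral>\<omega>. centred_sum n \<omega> ^ k * (X (Suc n) \<omega> - \<Theta> \<omega>) \<partial>M) = 0"
    using int eq by (simp add: right_diff_distrib)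
qed

lemma centred_sum_Suc: "centred_sum (Suc n) \<omega> = centred_sum n \<omega> + (X (Suc n) \<omega> - \<Theta> \<omega>)"
  by (simp add: centred_sum_def)

lemma centred_sum_second_moment: "(\<integral>\<omega>. centred_sum n \<omega> ^ 2 \<partial>M) \<le> real n"
proof (induction n)
  case 0
  show ?case by (simp add: centred_sum_def)
next
  case (Suc n)
  note [simp] = integrable_centred_sum_power centred_sum_power_orthogonal(1)[of n 1, simplified]
  have "(\<integral>\<omega>. centred_sum (Suc n) \<omega> ^ 2 \<partial>M) \<le>
      (\<integral>\<omega>. centred_sum n \<omega> ^ 2 + 2 * (centred_sum n \<omega> * (X (Suc n) \<omega> - \<Theta> \<omega>)) + 1 \<partial>M)"
  proof (rule integral_mono)
    fix \<omega> assume "\<omega> \<in> space M"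
    then have "\<bar>X (Suc n) \<omega> - \<Theta> \<omega>\<bar> \<le> 1" by (intro centred_abs_le) auto
    then have "(X (Suc n) \<omega> - \<Theta> \<omega>)\<^sup>2 \<le> 1" by (simp add: abs_square_le_1)
    then show "centred_sum (Suc n) \<omega> ^ 2 \<le>
        centred_sum n \<omega> ^ 2 + 2 * (centred_sum n \<omega> * (X (Suc n) \<omega> - \<Theta> \<omega>)) + 1"
      unfolding centred_sum_Suc power2_sum by (simp add: algebra_simps)
  qed auto
  also have "\<dots> = (\<integral>\<omega>. centred_sum n \<omega> ^ 2 \<partial>M) + 1"
    using centred_sum_power_orthogonal(2)[of n 1] by (simp add: prob_space)
  finally show ?case using Suc by simp
qed

text \<open>
  In the binomial expansion, the term linear in \<open>y\<close> is kept because its expectation will vanish;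
  the term \<open>4 d y\<^sup>3\<close> is absorbed by \<open>2 \<bar>d\<bar> \<le> 1 + d\<^sup>2\<close>.
\<close>

lemma fourth_power_add_le:
  fixes d y :: real
  assumes "\<bar>y\<bar> \<le> 1"
  shows "(d + y) ^ 4 \<le> d ^ 4 + 4 * (d ^ 3 * y) + 8 * d\<^sup>2 + 3"
proof -
  have y2: "y\<^sup>2 \<le> 1" using assms by (simp add: abs_square_le_1)
  then have y4: "y ^ 4 \<le> 1" using power_le_one[of "y\<^sup>2" 2] by simp
  have "\<bar>y ^ 3\<bar> \<le> 1" using assms by (simp add: power_abs power_le_one)
  then have "\<bar>d * y ^ 3\<bar> \<le> \<bar>d\<bar>" unfolding abs_mult by (simp add: mult_left_le)
  moreover have "2 * \<bar>d\<bar> \<le> 1 + d\<^sup>2"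
    using zero_le_power2[of "\<bar>d\<bar> - 1"] by (simp add: power2_eq_square algebra_simps)
  ultimately have "4 * (d * y ^ 3) \<le> 2 + 2 * d\<^sup>2" by linarith
  moreover have "d\<^sup>2 * y\<^sup>2 \<le> d\<^sup>2" using y2 by (simp add: mult_left_le)
  moreover have "(d + y) ^ 4 = d ^ 4 + 4 * (d ^ 3 * y) + 6 * (d\<^sup>2 * y\<^sup>2) + 4 * (d * y ^ 3) + y ^ 4"
    by (simp add: power4_eq_xxxx power3_eq_cube power2_eq_square algebra_simps)
  ultimately show ?thesis using y4 by linarith
qed

lemma centred_sum_fourth_moment: "(\<integral>\<omega>. centred_sum n \<omega> ^ 4 \<partial>M) \<le> 4 * (real n)\<^sup>2"
proof (induction n)
  case 0
  show ?case by (simp add: centred_sum_def)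
next
  case (Suc n)
  note [simp] = integrable_centred_sum_power centred_sum_power_orthogonal[of n 3]
  have "(\<integral>\<omega>. centred_sum (Suc n) \<omega> ^ 4 \<partial>M) \<le>
      (\<integral>\<omega>. centred_sum n \<omega> ^ 4 + 4 * (centred_sum n \<omega> ^ 3 * (X (Suc n) \<omega> - \<Theta> \<omega>)) +
         8 * (centred_sum n \<omega>)\<^sup>2 + 3 \<partial>M)"
  proof (rule integral_mono)
    fix \<omega> assume "\<omega> \<in> space M"
    then show "centred_sum (Suc n) \<omega> ^ 4 \<le> centred_sum n \<omega> ^ 4 +
        4 * (centred_sum n \<omega> ^ 3 * (X (Suc n) \<omega> - \<Theta> \<omega>)) + 8 * (centred_sum n \<omega>)\<^sup>2 + 3"
      unfolding centred_sum_Suc by (intro fourth_power_add_le centred_abs_le) auto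
  qed auto
  also have "\<dots> = (\<integral>\<omega>. centred_sum n \<omega> ^ 4 \<partial>M) + 8 * (\<integral>\<omega>. (centred_sum n \<omega>)\<^sup>2 \<partial>M) + 3"
    by (simp add: prob_space)
  also have "\<dots> \<le> 4 * (real n)\<^sup>2 + 8 * real n + 3"
    using Suc centred_sum_second_moment[of n] by simp
  also have "\<dots> \<le> 4 * (real (Suc n))\<^sup>2"
    by (simp add: power2_eq_square algebra_simps)
  finally show ?case .
qed

section \<open>The empirical mean\<close>

lemma empirical_mean_error:
  "n \<ge> 1 \<Longrightarrow> \<Theta> \<omega> - empirical_mean X n \<omega> = - centred_sum n \<omega> / real n"
  by (simp add: empirical_mean_def centred_sum_def sum_subtractf field_simps)

text \<open>The index \<open>Suc n\<close> avoids the degenerate mean of zero observations.\<close>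

lemma integrable_empirical_mean_error:
  "integrable M (\<lambda>\<omega>. (\<Theta> \<omega> - empirical_mean X (Suc n) \<omega>) ^ 4)"
  using integrable_centred_sum_power[of "Suc n" 4]
  by (simp add: empirical_mean_error power_divide)

lemma empirical_mean_error_moment4:
  "(\<integral>\<omega>. (\<Theta> \<omega> - empirical_mean X (Suc n) \<omega>) ^ 4 \<partial>M) \<le> 4 / (real (Suc n))\<^sup>2"
proof -
  have "(\<integral>\<omega>. (\<Theta> \<omega> - empirical_mean X (Suc n) \<omega>) ^ 4 \<partial>M) =
      (\<integral>\<omega>. centred_sum (Suc n) \<omega> ^ 4 \<partial>M) / real (Suc n) ^ 4"
    by (simp add: empirical_mean_error power_divide del: of_nat_Suc)
  also have "\<dots> \<le> 4 * (real (Suc n))\<^sup>2 / real (Suc n) ^ 4"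
    by (intro divide_right_mono centred_sum_fourth_moment) simp
  also have "\<dots> = 4 / (real (Suc n))\<^sup>2"
    by (simp add: power4_eq_xxxx power2_eq_square del: of_nat_Suc)
  finally show ?thesis .
qed

lemma summable_moment4_bound: "summable (\<lambda>n. 4 / (real (Suc n))\<^sup>2)"
  using summable_mult[OF inverse_power_summable[of 2, where 'a = real, THEN summable_Suc_iff[THEN iffD2]], of 4]
  by (simp add: field_simps)

lemma empirical_mean_tendsto: "AE \<omega> in M. (\<lambda>n. empirical_mean X n \<omega>) \<longlonglongrightarrow> \<Theta> \<omega>"
proof -
  have "summable (\<lambda>n. \<integral>\<omega>. (\<Theta> \<omega> - empirical_mean X (Suc n) \<omega>) ^ 4 \<partial>M)"
    using empirical_mean_error_moment4
    by (intro summable_comparison_test'[OF summable_moment4_bound, of 0]) auto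
  then have "AE \<omega> in M. (\<lambda>n. \<Theta> \<omega> - empirical_mean X (Suc n) \<omega>) \<longlonglongrightarrow> 0"
    by (rule AE_tendsto_zero_if_summable_moment4[OF integrable_empirical_mean_error])
  then show ?thesis
  proof eventually_elim
    case (elim \<omega>)
    then have "(\<lambda>n. empirical_mean X (Suc n) \<omega>) \<longlonglongrightarrow> \<Theta> \<omega>"
      using tendsto_diff[OF tendsto_const[of "\<Theta> \<omega>"] elim] by simp
    then show ?case by (rule LIMSEQ_imp_Suc)
  qed
qed

section \<open>The predictive probabilities\<close>

text \<open>The \<open>\<sigma>\<close>-algebra generated by the first \<open>t\<close> observations.\<close>

abbreviation F :: "nat \<Rightarrow> 'a measure" where "F \<equiv> natural_filtration M X"

lemma natural_filtration_generator_Pow: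
  "(\<Union>i\<in>{1..t}. {X i -` A \<inter> space M | A. A \<in> sets borel}) \<subseteq> Pow (space M)"
  by auto

lemma space_natural_filtration [simp]: "space (F t) = space M"
  by (simp add: natural_filtration_def space_measure_of_conv)

lemma sets_natural_filtration:
  "sets (F t) = sigma_sets (space M) (\<Union>i\<in>{1..t}. {X i -` A \<inter> space M | A. A \<in> sets borel})"
  unfolding natural_filtration_def by (rule sets_measure_of[OF natural_filtration_generator_Pow])

lemma natural_filtration_subalgebra_latent: "subalgebra (latent_filtration n) (F n)"
proof -
  have "sets (F n) \<subseteq> sets (latent_filtration n)"
    unfolding sets_natural_filtration space_latent_filtration[of n, symmetric]
    by (rule sets.sigma_sets_subset) (auto intro!: measurable_sets X_latent_filtration)
  then show ?thesis by (simp add: subalgebra_def space_latent_filtration)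
qed

lemma natural_filtration_subalgebra: "subalgebra M (F t)"
  using natural_filtration_subalgebra_latent[of t] latent_filtration_subalgebra[of t]
  by (auto simp: subalgebra_def)

lemma natural_filtration_finite: "finite_measure_subalgebra M (F t)"
  by unfold_locales (rule natural_filtration_subalgebra)

lemma natural_filtration_mono: "s \<le> t \<Longrightarrow> sets (F s) \<subseteq> sets (F t)"
  unfolding sets_natural_filtration by (rule sigma_sets_mono') force

lemma empirical_mean_natural_filtration: "empirical_mean X n \<in> borel_measurable (F n)"
proof -
  have "X i \<in> borel_measurable (F n)" if "i \<in> {1..n}" for i
  proof (rule measurableI)
    fix A :: "real set" assume "A \<in> sets borel"
    then show "X i -` A \<inter> space (F n) \<in> sets (F n)"
      using that by (auto simp only: sets_natural_filtration space_natural_filtration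
          intro!: sigma_sets.Basic)
  qed simp
  then show ?thesis unfolding empirical_mean_def by measurable
qed

text \<open>
  The one-step prediction from the past is the projection of \<open>\<Theta>\<close>: condition first on the parameter
  and the past, then on the past alone.
\<close>

lemma predictive_prob_eq_cond_exp_latent:
  "AE \<omega> in M. predictive_prob M X t \<omega> = real_cond_exp M (F t) \<Theta> \<omega>"
proof -
  interpret F: finite_measure_subalgebra M "F t" by (rule natural_filtration_finite)
  let ?G = "latent_filtration t"
  have [measurable]: "X (Suc t) \<in> borel_measurable M" by (simp add: X_measurable)
  have "AE \<omega> in M. predictive_prob M X t \<omega> = real_cond_exp M (F t) (X (Suc t)) \<omega>"
    unfolding predictive_prob_def subalg_prob_def
    by (rule F.real_cond_exp_cong) (use X_binary[of "Suc t"] in \<open>auto simp: indicator_def\<close>)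
  moreover have "AE \<omega> in M. real_cond_exp M (F t) (real_cond_exp M ?G (X (Suc t))) \<omega> =
      real_cond_exp M (F t) (X (Suc t)) \<omega>"
    by (intro F.real_cond_exp_nested_subalg latent_filtration_subalgebra
        natural_filtration_subalgebra_latent integrable_X) simp
  moreover have "AE \<omega> in M. real_cond_exp M (F t) (real_cond_exp M ?G (X (Suc t))) \<omega> =
      real_cond_exp M (F t) \<Theta> \<omega>"
    by (rule F.real_cond_exp_cong[OF cond_exp_next_given_latent_past]) auto
  ultimately show ?thesis by eventually_elim simp
qed

lemma predictive_prob_martingale: "martingale M F (predictive_prob M X)"
  unfolding martingale_def
proof (intro conjI allI impI)
  show "filtration (space M) F"
    by unfold_locales (simp_all add: natural_filtration_mono)
  show "subalgebra M (F t)" for t by (rule natural_filtration_subalgebra)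
  show "predictive_prob M X t \<in> borel_measurable (F t)" for t
    unfolding predictive_prob_def subalg_prob_def by simp
  show "integrable M (predictive_prob M X t)" for t
  proof -
    interpret F: finite_measure_subalgebra M "F t" by (rule natural_filtration_finite)
    show ?thesis
      unfolding predictive_prob_def subalg_prob_def
      using success_sets[of "t + 1"] by (intro F.real_cond_exp_int(1) integrable_real_indicator)
         (auto simp: less_top[symmetric])
  qed
  fix s t :: nat assume "s \<le> t"
  interpret F: finite_measure_subalgebra M "F s" by (rule natural_filtration_finite)
  have [measurable]: "predictive_prob M X t \<in> borel_measurable M"
    unfolding predictive_prob_def subalg_prob_def by simp
  have "AE \<omega> in M. real_cond_exp M (F s) (predictive_prob M X t) \<omega> =
      real_cond_exp M (F s) (real_cond_exp M (F t) \<Theta>) \<omega>"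
    by (rule F.real_cond_exp_cong[OF predictive_prob_eq_cond_exp_latent]) auto
  moreover have "AE \<omega> in M. real_cond_exp M (F s) (real_cond_exp M (F t) \<Theta>) \<omega> = real_cond_exp M (F s) \<Theta> \<omega>"
    using natural_filtration_mono[OF \<open>s \<le> t\<close>]
    by (intro F.real_cond_exp_nested_subalg natural_filtration_subalgebra integrable_\<Theta>)
       (auto simp: subalgebra_def)
  ultimately show "AE \<omega> in M. real_cond_exp M (F s) (predictive_prob M X t) \<omega> = predictive_prob M X s \<omega>"
    using predictive_prob_eq_cond_exp_latent[of s] by eventually_elim simp
qed

lemma predictive_prob_bounded: "AE \<omega> in M. \<forall>t. \<bar>predictive_prob M X t \<omega>\<bar> \<le> 1"
  unfolding AE_all_countable
proof
  fix t
  interpret F: finite_measure_subalgebra M "F t" by (rule natural_filtration_finite)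
  have "AE \<omega> in M. real_cond_exp M (F t) \<Theta> \<omega> \<ge> 0"
    using \<Theta>_range by (intro F.real_cond_exp_ge_c integrable_\<Theta>) auto
  moreover have "AE \<omega> in M. real_cond_exp M (F t) \<Theta> \<omega> \<le> 1"
    using \<Theta>_range by (intro F.real_cond_exp_le_c integrable_\<Theta>) auto
  ultimately show "AE \<omega> in M. \<bar>predictive_prob M X t \<omega>\<bar> \<le> 1"
    using predictive_prob_eq_cond_exp_latent[of t] by eventually_elim simp
qed

text \<open>
  The bound of \<open>empirical_mean_error_moment4\<close> survives projection onto the natural filtration.
\<close>

lemma predictive_error_moment4:
  "integrable M (\<lambda>\<omega>. (predictive_prob M X (Suc n) \<omega> - empirical_mean X (Suc n) \<omega>) ^ 4)"
  "(\<integral>\<omega>. (predictive_prob M X (Suc n) \<omega> - empirical_mean X (Suc n) \<omega>) ^ 4 \<partial>M) \<le> 4 / (real (Suc n))\<^sup>2"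
proof -
  let ?m = "empirical_mean X (Suc n)" and ?p = "predictive_prob M X (Suc n)"
  let ?Z = "\<lambda>\<omega>. \<Theta> \<omega> - ?m \<omega>"
  interpret F: finite_measure_subalgebra M "F (Suc n)" by (rule natural_filtration_finite)
  have [measurable]: "?m \<in> borel_measurable M"
    by (rule measurable_from_subalg[OF natural_filtration_subalgebra empirical_mean_natural_filtration])
  have [measurable]: "?p \<in> borel_measurable M"
    unfolding predictive_prob_def subalg_prob_def by simp
  have int_Z: "integrable M ?Z"
    using integrable_centred_sum_power[of "Suc n" 1] by (simp add: empirical_mean_error)
  have int_m: "integrable M ?m"
    using Bochner_Integration.integrable_diff[OF integrable_\<Theta> int_Z] by simp
  have "AE \<omega> in M. real_cond_exp M (F (Suc n)) ?Z \<omega> =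
      real_cond_exp M (F (Suc n)) \<Theta> \<omega> - real_cond_exp M (F (Suc n)) ?m \<omega>"
    by (intro F.real_cond_exp_diff integrable_\<Theta> int_m)
  moreover have "AE \<omega> in M. real_cond_exp M (F (Suc n)) ?m \<omega> = ?m \<omega>"
    by (intro F.real_cond_exp_F_meas int_m empirical_mean_natural_filtration)
  ultimately have proj: "AE \<omega> in M. ?p \<omega> - ?m \<omega> = real_cond_exp M (F (Suc n)) ?Z \<omega>"
    using predictive_prob_eq_cond_exp_latent[of "Suc n"] by eventually_elim simp
  have "AE \<omega> in M. real_cond_exp M (F (Suc n)) ?Z \<omega> ^ 4 \<le>
      real_cond_exp M (F (Suc n)) (\<lambda>\<omega>. ?Z \<omega> ^ 4) \<omega>"
    by (rule F.real_cond_exp_jensens_inequality(2)[where I = UNIV and q = "\<lambda>x. x ^ 4"])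
       (auto intro!: int_Z integrable_empirical_mean_error convex_power_even)
  with proj have le: "AE \<omega> in M. (?p \<omega> - ?m \<omega>) ^ 4 \<le>
      real_cond_exp M (F (Suc n)) (\<lambda>\<omega>. ?Z \<omega> ^ 4) \<omega>"
    by eventually_elim simp
  note int_c = F.real_cond_exp_int[OF integrable_empirical_mean_error[of n]]
  show int: "integrable M (\<lambda>\<omega>. (?p \<omega> - ?m \<omega>) ^ 4)"
    by (rule Bochner_Integration.integrable_bound[OF int_c(1)])
       (use le in \<open>auto elim!: eventually_mono\<close>)
  have "(\<integral>\<omega>. (?p \<omega> - ?m \<omega>) ^ 4 \<partial>M) \<le> (\<integral>\<omega>. ?Z \<omega> ^ 4 \<partial>M)"
    using integral_mono_AE[OF int int_c(1) le] int_c(2) by simp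
  also note empirical_mean_error_moment4[of n]
  finally show "(\<integral>\<omega>. (?p \<omega> - ?m \<omega>) ^ 4 \<partial>M) \<le> 4 / (real (Suc n))\<^sup>2" .
qed

lemma predictive_prob_tendsto: "AE \<omega> in M. (\<lambda>t. predictive_prob M X t \<omega>) \<longlonglongrightarrow> \<Theta> \<omega>"
proof -
  have "summable (\<lambda>n. \<integral>\<omega>. (predictive_prob M X (Suc n) \<omega> - empirical_mean X (Suc n) \<omega>) ^ 4 \<partial>M)"
    using predictive_error_moment4(2)
    by (intro summable_comparison_test'[OF summable_moment4_bound, of 0]) auto
  then have "AE \<omega> in M. (\<lambda>n. predictive_prob M X (Suc n) \<omega> - empirical_mean X (Suc n) \<omega>) \<longlonglongrightarrow> 0"
    by (rule AE_tendsto_zero_if_summable_moment4[OF predictive_error_moment4(1)])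
  then show ?thesis
    using empirical_mean_tendsto
  proof eventually_elim
    case (elim \<omega>)
    have "(\<lambda>n. empirical_mean X (Suc n) \<omega>) \<longlonglongrightarrow> \<Theta> \<omega>"
      using elim(2) by (rule LIMSEQ_Suc)
    then have "(\<lambda>n. predictive_prob M X (Suc n) \<omega>) \<longlonglongrightarrow> \<Theta> \<omega>"
      using tendsto_add[OF elim(1)] by fastforce
    then show ?case by (rule LIMSEQ_imp_Suc)
  qed
qed

end

theorem proposition2:
  fixes M :: "'a measure" and X :: "nat \<Rightarrow> 'a \<Rightarrow> real" and \<Theta> :: "'a \<Rightarrow> real"
  assumes "prob_space M"
    and "\<And>t. t \<ge> 1 \<Longrightarrow> X t \<in> borel_measurable M"
    and "\<And>t \<omega>. t \<ge> 1 \<Longrightarrow> \<omega> \<in> space M \<Longrightarrow> X t \<omega> \<in> {0, 1}"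
    and "exchangeable M X"
    and "\<Theta> \<in> borel_measurable M"
    and "\<And>\<omega>. \<omega> \<in> space M \<Longrightarrow> \<Theta> \<omega> \<in> {0..1}"
    and "cond_iid_bernoulli M \<Theta> X {1..}"
  shows "(bounded_martingale M (natural_filtration M X) (predictive_prob M X) \<and>
          (AE \<omega> in M. (\<lambda>t. predictive_prob M X t \<omega>) \<longlonglongrightarrow> \<Theta> \<omega>)) \<and>
         (AE \<omega> in M. (\<lambda>n. empirical_mean X n \<omega>) \<longlonglongrightarrow> \<Theta> \<omega>)"
proof -
  interpret bernoulli_mixture M X \<Theta>
    using assms by (intro bernoulli_mixture.intro bernoulli_mixture_axioms.intro) auto
  show ?thesis
    unfolding bounded_martingale_def
    using predictive_prob_martingale predictive_prob_bounded predictive_prob_tendsto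
      empirical_mean_tendsto by blast
qed

end
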